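(* Let $\mathcal H$ be the Hopf algebra of a minors system $\mathcal S$, and let $\delta_{\mathbf a}$ and $\delta_{\mathbf b}$ be uniform selectors. Then the canonical Tutte polynomial $\alpha=\alpha(\mathbf a,\mathbf b)$ satisfies $\alpha(S)=1$ for $S\in\mathcal S_0$, and for every $S\notin\mathcal S_0$ and every $e\in E(S)$, $$\alpha(S)=\delta_{\mathbf b}\big(S/\!/(E(S)\setminus\{e\})\big)\cdot\alpha(S\backslash\!\backslash e)+\delta_{\mathbf a}\big(S\backslash\!\backslash(E(S)\setminus\{e\})\big)\cdot\alpha(S/\!/e).$$
   Context: A minors system: graded set $\mathcal S=\bigcup_{n\ge0}\mathcal S_n$, each $S\in\mathcal S_n$ with a set $E(S)$ of $n$ elements, unique $1\in\mathcal S_0$, and operations $S\backslash\!\backslash e$, $S/\!/e$ ($e\in E(S)$) with $E(S\backslash\!\backslash e)=E(S/\!/e)=E(S)\setminus\{e\}$, all pairs of operations on distinct elements commuting; $S\backslash\!\backslash A$, $S/\!/A$ apply the operation to all of $A$. Its Hopf algebra $\mathcal H$ is the free module with basis $\mathcal S$ (over a field of characteristic 0), $\mathcal H_n=\mathrm{span}\,\mathcal S_n$, with coproduct $\Delta(S)=\sum_{A\subseteq E(S)}(S\backslash\!\backslash A^c)\otimes(S/\!/A)$, counit $\varepsilon(S)=1$ iff $S\in\mathcal S_0$, and a multiplication with unit $1$ satisfying $E(S_1S_2)=E(S_1)\sqcup E(S_2)$ and compatible with both minor operations. With $\{S_i\}_{i\in I}=\mathcal S_1$, $\delta_i$ is the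 linear map with $\delta_i(S_i)=1$ and $0$ on all other elements of $\mathcal S$; a selector is $\delta_{\mathbf a}=\sum_i a_i\delta_i$ with $a_i$ polynomials (rational exponents allowed) in indeterminates. $f*g=m\circ(f\otimes g)\circ\Delta$, $\exp_*(\delta)=\sum_{k\ge0}\delta^{*k}/k!$ with $\delta^{*0}=\varepsilon$, and $\alpha(\mathbf a,\mathbf b)=\exp_*(\delta_{\mathbf a})*\exp_*(\delta_{\mathbf b})$. A selector $\delta$ is uniform if for every $S\in\mathcal S$ and $k\ge1$, $\delta^{\otimes k}$ takes the same value on every summand of $\Delta^{(k-1)}(S)$ all of whose tensor factors lie in $\mathcal S_1$. *)

theory Defs
  imports Complex_Main "HOL-Library.Poly_Mapping"
begin

section \<open>Minors systems\<close>

text \<open>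
  The type \<open>'s\<close> is the underlying set of the minors system, \<open>'e\<close> supplies the elements of the
  ground sets. The operations are total functions, but their values matter only for
  \<open>e \<in> ground M S\<close>, respectively for a product of two objects with disjoint ground sets.
\<close>

record ('s, 'e) minors_struct =
  ground :: "'s \<Rightarrow> 'e set"
  del :: "'s \<Rightarrow> 'e \<Rightarrow> 's"
  contr :: "'s \<Rightarrow> 'e \<Rightarrow> 's"
  mul :: "'s \<Rightarrow> 's \<Rightarrow> 's"
  one :: "'s"

text \<open>An object of degree \<open>n\<close> has exactly \<open>n\<close> elements, so the ground sets determine the grading.\<close>

definition grade :: "('s, 'e) minors_struct \<Rightarrow> nat \<Rightarrow> 's set" where
  "grade M n = {S. finite (ground M S) \<and> card (ground M S) = n}"

text \<open>
  Ground sets are honest sets and \<open>ground M (del M S e) = ground M S - {e}\<close> is an equality of sets. Under this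
  reading \<open>E(S\<^sub>1 S\<^sub>2) = E(S\<^sub>1) \<squnion> E(S\<^sub>2)\<close> can only be asked for when the ground sets are disjoint: for
  \<open>S \<in> \<S>\<^sub>1\<close> with \<open>E(S) = {e}\<close>, removing either element of the two-element set \<open>E(S S)\<close> would have
  to leave \<open>1 \<cdot> S = S\<close>, whose ground set is \<open>{e}\<close>.
\<close>

locale minors_system =
  fixes M :: "('s, 'e) minors_struct"
  assumes graded: "(\<Union>n. grade M n) = UNIV"
    and grade_zero: "grade M 0 = {one M}"
    and ground_del: "e \<in> ground M S \<Longrightarrow> ground M (del M S e) = ground M S - {e}"
    and ground_contr: "e \<in> ground M S \<Longrightarrow> ground M (contr M S e) = ground M S - {e}"
    and del_del: "\<lbrakk>e \<in> ground M S; f \<in> ground M S; e \<noteq> f\<rbrakk>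
      \<Longrightarrow> del M (del M S e) f = del M (del M S f) e"
    and contr_contr: "\<lbrakk>e \<in> ground M S; f \<in> ground M S; e \<noteq> f\<rbrakk>
      \<Longrightarrow> contr M (contr M S e) f = contr M (contr M S f) e"
    and del_contr: "\<lbrakk>e \<in> ground M S; f \<in> ground M S; e \<noteq> f\<rbrakk>
      \<Longrightarrow> contr M (del M S e) f = del M (contr M S f) e"
    and mul_one_left: "mul M (one M) S = S"
    and mul_one_right: "mul M S (one M) = S"
    and mul_assoc: "\<lbrakk>ground M S \<inter> ground M T = {}; ground M S \<inter> ground M U = {};
        ground M T \<inter> ground M U = {}\<rbrakk>
      \<Longrightarrow> mul M (mul M S T) U = mul M S (mul M T U)"
    and ground_mul: "ground M S \<inter> ground M T = {}
      \<Longrightarrow> ground M (mul M S T) = ground M S \<union> ground M T"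
    and del_mul_left: "\<lbrakk>ground M S \<inter> ground M T = {}; e \<in> ground M S\<rbrakk>
      \<Longrightarrow> del M (mul M S T) e = mul M (del M S e) T"
    and del_mul_right: "\<lbrakk>ground M S \<inter> ground M T = {}; e \<in> ground M T\<rbrakk>
      \<Longrightarrow> del M (mul M S T) e = mul M S (del M T e)"
    and contr_mul_left: "\<lbrakk>ground M S \<inter> ground M T = {}; e \<in> ground M S\<rbrakk>
      \<Longrightarrow> contr M (mul M S T) e = mul M (contr M S e) T"
    and contr_mul_right: "\<lbrakk>ground M S \<inter> ground M T = {}; e \<in> ground M T\<rbrakk>
      \<Longrightarrow> contr M (mul M S T) e = mul M S (contr M T e)"

text \<open>
  Operations on all elements of a finite set, taken in some order. For \<open>A \<subseteq> ground M S\<close> the order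
  does not matter in a minors system, since operations on distinct elements commute.
\<close>

definition some_enum :: "'e set \<Rightarrow> 'e list" where
  "some_enum A = (SOME xs. distinct xs \<and> set xs = A)"

definition del_set :: "('s, 'e) minors_struct \<Rightarrow> 's \<Rightarrow> 'e set \<Rightarrow> 's" where
  "del_set M S A = foldl (del M) S (some_enum A)"

definition contr_set :: "('s, 'e) minors_struct \<Rightarrow> 's \<Rightarrow> 'e set \<Rightarrow> 's" where
  "contr_set M S A = foldl (contr M) S (some_enum A)"


section \<open>Free modules and linear maps\<close>

text \<open>
  The free \<open>'k\<close>-module with basis \<open>'b\<close> is the type \<open>'b \<Rightarrow>\<^sub>0 'k\<close>, and the tensor product of the free
  modules with bases \<open>'b\<close> and \<open>'c\<close> is the free module with basis \<open>'b \<times> 'c\<close>. The \<open>k\<close>-th tensor power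
  is the part of \<open>'b list \<Rightarrow>\<^sub>0 'k\<close> supported on lists of length \<open>k\<close>. A list \<open>[T\<^sub>1, \<dots>, T\<^sub>k]\<close> stands
  for \<open>T\<^sub>1 \<otimes> \<dots> \<otimes> T\<^sub>k\<close>.
\<close>

abbreviation basis :: "'b \<Rightarrow> ('b \<Rightarrow>\<^sub>0 'k::field_char_0)" where
  "basis x \<equiv> Poly_Mapping.single x 1"

definition smult :: "'k::field_char_0 \<Rightarrow> ('b \<Rightarrow>\<^sub>0 'k) \<Rightarrow> ('b \<Rightarrow>\<^sub>0 'k)" where
  "smult c p = Poly_Mapping.map (\<lambda>x. c * x) p"

text \<open>The linear map with prescribed values on the basis.\<close>

definition lin_ext :: "('b \<Rightarrow> ('c \<Rightarrow>\<^sub>0 'k::field_char_0)) \<Rightarrow> ('b \<Rightarrow>\<^sub>0 'k) \<Rightarrow> ('c \<Rightarrow>\<^sub>0 'k)" where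
  "lin_ext f h = (\<Sum>x\<in>Poly_Mapping.keys h. smult (Poly_Mapping.lookup h x) (f x))"

text \<open>
  Polynomials with rational exponents in the indeterminates \<open>'x\<close>: a monomial is a finitely
  supported exponent function \<open>'x \<Rightarrow>\<^sub>0 rat\<close>, and multiplication is the convolution product of
  \<^theory>\<open>HOL-Library.Poly_Mapping\<close>.
\<close>

type_synonym ('x, 'k) rpoly = "('x \<Rightarrow>\<^sub>0 rat) \<Rightarrow>\<^sub>0 'k"


section \<open>The coalgebra and convolution\<close>

definition coprod :: "('s, 'e) minors_struct \<Rightarrow> ('s \<Rightarrow>\<^sub>0 'k::field_char_0) \<Rightarrow> (('s \<times> 's) \<Rightarrow>\<^sub>0 'k)" where
  "coprod M = lin_ext (\<lambda>S. \<Sum>A\<in>Pow (ground M S).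
     basis (del_set M S (ground M S - A), contr_set M S A))"

definition counit :: "('s, 'e) minors_struct \<Rightarrow> ('s \<Rightarrow>\<^sub>0 'k::field_char_0) \<Rightarrow> ('x, 'k) rpoly" where
  "counit M = lin_ext (\<lambda>S. if S \<in> grade M 0 then 1 else 0)"

text \<open>\<open>mult_tensor f g\<close> is the composition of \<open>f \<otimes> g\<close> with the multiplication of the target ring.\<close>

definition mult_tensor :: "(('s \<Rightarrow>\<^sub>0 'k::field_char_0) \<Rightarrow> ('x, 'k) rpoly) \<Rightarrow>
    (('s \<Rightarrow>\<^sub>0 'k) \<Rightarrow> ('x, 'k) rpoly) \<Rightarrow> (('s \<times> 's) \<Rightarrow>\<^sub>0 'k) \<Rightarrow> ('x, 'k) rpoly" where
  "mult_tensor f g = lin_ext (\<lambda>(S, T). f (basis S) * g (basis T))"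

definition conv :: "('s, 'e) minors_struct \<Rightarrow> (('s \<Rightarrow>\<^sub>0 'k::field_char_0) \<Rightarrow> ('x, 'k) rpoly) \<Rightarrow>
    (('s \<Rightarrow>\<^sub>0 'k) \<Rightarrow> ('x, 'k) rpoly) \<Rightarrow> ('s \<Rightarrow>\<^sub>0 'k) \<Rightarrow> ('x, 'k) rpoly" where
  "conv M f g = mult_tensor f g \<circ> coprod M"

primrec conv_power :: "('s, 'e) minors_struct \<Rightarrow> (('s \<Rightarrow>\<^sub>0 'k::field_char_0) \<Rightarrow> ('x, 'k) rpoly) \<Rightarrow>
    nat \<Rightarrow> ('s \<Rightarrow>\<^sub>0 'k) \<Rightarrow> ('x, 'k) rpoly" where
  "conv_power M f 0 = counit M"
| "conv_power M f (Suc k) = conv M f (conv_power M f k)"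

text \<open>
  The exponential series is locally finite for the maps of interest (those vanishing outside degree
  one). \<^const>\<open>Sum_any\<close> is the sum over the indices with non-zero summand.
\<close>

definition conv_exp :: "('s, 'e) minors_struct \<Rightarrow> (('s \<Rightarrow>\<^sub>0 'k::field_char_0) \<Rightarrow> ('x, 'k) rpoly) \<Rightarrow>
    ('s \<Rightarrow>\<^sub>0 'k) \<Rightarrow> ('x, 'k) rpoly" where
  "conv_exp M f h = Sum_any (\<lambda>k. smult (1 / fact k) (conv_power M f k h))"


section \<open>Selectors and the canonical Tutte polynomial\<close>

text \<open>The degree-one objects index themselves, so \<open>\<delta>\<^sub>i\<close> and \<open>a\<^sub>i\<close> are indexed by \<open>i \<in> grade M 1\<close>.\<close>

definition delta :: "'s \<Rightarrow> ('s \<Rightarrow>\<^sub>0 'k::field_char_0) \<Rightarrow> ('x, 'k) rpoly" where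
  "delta i = lin_ext (\<lambda>S. if S = i then 1 else 0)"

definition selector :: "('s, 'e) minors_struct \<Rightarrow> ('s \<Rightarrow> ('x, 'k::field_char_0) rpoly) \<Rightarrow>
    ('s \<Rightarrow>\<^sub>0 'k) \<Rightarrow> ('x, 'k) rpoly" where
  "selector M a h = Sum_any (\<lambda>i. if i \<in> grade M 1 then a i * delta i h else 0)"

definition canonical_tutte :: "('s, 'e) minors_struct \<Rightarrow> ('s \<Rightarrow> ('x, 'k::field_char_0) rpoly) \<Rightarrow>
    ('s \<Rightarrow> ('x, 'k) rpoly) \<Rightarrow> ('s \<Rightarrow>\<^sub>0 'k) \<Rightarrow> ('x, 'k) rpoly" where
  "canonical_tutte M a b = conv M (conv_exp M (selector M a)) (conv_exp M (selector M b))"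

text \<open>
  \<open>iter_coprod M n\<close> is the iterated coproduct with values in the \<open>(n + 1)\<close>-st tensor power, given
  by \<open>\<Delta>\<^sub>0 = id\<close> and \<open>\<Delta>\<^sub>n\<^sub>+\<^sub>1 = (id \<otimes> \<Delta>\<^sub>n) \<circ> \<Delta>\<close>.
\<close>

definition tensor_cons :: "'s \<Rightarrow> ('s list \<Rightarrow>\<^sub>0 'k::field_char_0) \<Rightarrow> ('s list \<Rightarrow>\<^sub>0 'k)" where
  "tensor_cons S = lin_ext (\<lambda>ts. basis (S # ts))"

primrec iter_coprod :: "('s, 'e) minors_struct \<Rightarrow> nat \<Rightarrow> ('s \<Rightarrow>\<^sub>0 'k::field_char_0) \<Rightarrow>
    ('s list \<Rightarrow>\<^sub>0 'k)" where
  "iter_coprod M 0 = lin_ext (\<lambda>S. basis [S])"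
| "iter_coprod M (Suc n) =
     lin_ext (\<lambda>(S, T). tensor_cons S (iter_coprod M n (basis T))) \<circ> coprod M"

text \<open>\<open>\<delta>\<^sup>\<otimes>\<^sup>k\<close> on all tensor powers at once, with the values multiplied in the target ring.\<close>

definition tensor_power :: "(('s \<Rightarrow>\<^sub>0 'k::field_char_0) \<Rightarrow> ('x, 'k) rpoly) \<Rightarrow>
    ('s list \<Rightarrow>\<^sub>0 'k) \<Rightarrow> ('x, 'k) rpoly" where
  "tensor_power f = lin_ext (\<lambda>ts. \<Prod>T\<leftarrow>ts. f (basis T))"

text \<open>
  In characteristic 0 no cancellation occurs in an iterated coproduct of a basis element, so its
  summands are the basis tensors in its support.
\<close>

definition summands :: "'k::field_char_0 itself \<Rightarrow> ('s, 'e) minors_struct \<Rightarrow> nat \<Rightarrow> 's \<Rightarrow> 's list set"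
  where "summands _ M n S = Poly_Mapping.keys (iter_coprod M n (basis S) :: 's list \<Rightarrow>\<^sub>0 'k)"

definition uniform :: "('s, 'e) minors_struct \<Rightarrow> (('s \<Rightarrow>\<^sub>0 'k::field_char_0) \<Rightarrow> ('x, 'k) rpoly) \<Rightarrow> bool"
  where "uniform M f \<longleftrightarrow> (\<forall>S. \<forall>k\<ge>1. \<forall>t\<in>summands TYPE('k) M (k - 1) S. \<forall>u\<in>summands TYPE('k) M (k - 1) S.
     set t \<subseteq> grade M 1 \<longrightarrow> set u \<subseteq> grade M 1 \<longrightarrow> tensor_power f (basis t) = tensor_power f (basis u))"

end

theory Submission
  imports Defs
begin

text \<open>
  For a uniform selector \<open>\<delta>\<close> and an object \<open>S\<close> with \<open>n\<close> elements, \<open>\<delta>\<^sup>*\<^sup>n(S)\<close> is a sum over the \<open>n!\<close>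
  orderings of \<open>E(S)\<close> whose terms all agree, so that \<open>exp\<^sub>*(\<delta>)(S)\<close> is the common value. Evaluating
  it on an ordering that begins, respectively ends, with \<open>e\<close> splits off a factor \<open>\<delta>(S\(E - e))\<close>
  from \<open>exp\<^sub>*(\<delta>)(S/e)\<close>, respectively \<open>\<delta>(S/(E - e))\<close> from \<open>exp\<^sub>*(\<delta>)(S\e)\<close>. In
  \<open>\<alpha>(S) = \<Sum>\<^sub>A exp\<^sub>*(\<delta>\<^sub>a)(S\A\<^sup>c) exp\<^sub>*(\<delta>\<^sub>b)(S/A)\<close> the first is applied to the terms with \<open>e \<in> A\<close>,
  the second to those with \<open>e \<notin> A\<close>.
\<close>

section \<open>Linear extension\<close>

lemma lookup_smult: "Poly_Mapping.lookup (smult c p) x = c * Poly_Mapping.lookup p x"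
  by (simp add: smult_def Poly_Mapping.map.rep_eq when_def)

lemma smult_0 [simp]: "smult 0 p = 0" "smult c 0 = 0"
  by (auto intro!: poly_mapping_eqI simp: lookup_smult)

lemma smult_1 [simp]: "smult 1 p = p"
  by (auto intro!: poly_mapping_eqI simp: lookup_smult)

lemma smult_add_left: "smult (c + d) p = smult c p + smult d p"
  by (auto intro!: poly_mapping_eqI simp: lookup_smult lookup_add algebra_simps)

text \<open>Scaling by \<open>c\<close> is multiplication by the constant
  \<open>Poly_Mapping.single 0 c\<close>, and numerals are constants too. This later cancels 1/n!, a
  scalar of the field, against n!, an element of the polynomial ring.\<close>

lemma smult_inverse_of_nat_mult:
  fixes p :: "'b::monoid_add \<Rightarrow>\<^sub>0 'k::field_char_0"
  assumes "n \<noteq> 0"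
  shows "smult (1 / of_nat n) (of_nat n * p) = p"
proof -
  have "smult (1 / of_nat n) q = Poly_Mapping.single 0 (1 / of_nat n) * q" for q :: "'b \<Rightarrow>\<^sub>0 'k"
    unfolding smult_def by (rule mult_map_scale_conv_mult)
  moreover have "(of_nat n :: 'b \<Rightarrow>\<^sub>0 'k) = Poly_Mapping.single 0 (of_nat n)"
    by simp
  ultimately show ?thesis
    using assms by (simp add: mult.assoc [symmetric] mult_single del: single_of_nat)
qed

text \<open>Lets arguments with different supports be summed over one common finite set, as
  additivity requires.\<close>

lemma lin_ext_superset:
  assumes "finite X" "Poly_Mapping.keys h \<subseteq> X"
  shows "lin_ext f h = (\<Sum>x\<in>X. smult (Poly_Mapping.lookup h x) (f x))"
  unfolding lin_ext_def
  by (rule sum.mono_neutral_left) (use assms in \<open>auto simp: in_keys_iff\<close>)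

lemma lin_ext_basis [simp]: "lin_ext f (basis x) = f x"
  by (simp add: lin_ext_def)

lemma lin_ext_add: "lin_ext f (p + q) = lin_ext f p + lin_ext f q"
proof -
  let ?X = "Poly_Mapping.keys p \<union> Poly_Mapping.keys q"
  have "Poly_Mapping.keys (p + q) \<subseteq> ?X"
    by (rule keys_add)
  then show ?thesis
    by (simp add: lin_ext_superset [of ?X] lookup_add smult_add_left sum.distrib)
qed

lemma lin_ext_sum: "lin_ext f (\<Sum>i\<in>I. p i) = (\<Sum>i\<in>I. lin_ext f (p i))"
proof (induction I rule: infinite_finite_induct)
  case (infinite I)
  then show ?case by (simp add: lin_ext_def)
qed (simp_all add: lin_ext_add, simp add: lin_ext_def)

text \<open>Prepending \<open>S\<close> is injective on lists, so each coefficient comes from at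
  most one list of \<open>p\<close>.\<close>

lemma lookup_tensor_cons:
  "Poly_Mapping.lookup (tensor_cons S p) us =
    (case us of [] \<Rightarrow> 0 | U # us' \<Rightarrow> if U = S then Poly_Mapping.lookup p us' else 0)"
proof -
  have "Poly_Mapping.lookup (tensor_cons S p) us =
      (\<Sum>ts\<in>Poly_Mapping.keys p. if S # ts = us then Poly_Mapping.lookup p ts else 0)"
    unfolding tensor_cons_def lin_ext_def
    by (auto simp: lookup_sum lookup_smult lookup_single when_def intro!: sum.cong)
  then show ?thesis
    by (auto simp: sum.delta in_keys_iff split: list.split)
qed

lemma sum_in_Nats: "(\<And>i. i \<in> I \<Longrightarrow> f i \<in> \<nat>) \<Longrightarrow> (\<Sum>i\<in>I. f i) \<in> \<nat>"
  by (induction I rule: infinite_finite_induct) auto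


section \<open>Commuting operations that remove elements\<close>

text \<open>Deletion and contraction are both instances, so independence of the order of removal is
  proved once for both.\<close>

locale removal =
  fixes gr :: "'s \<Rightarrow> 'e set" and r :: "'s \<Rightarrow> 'e \<Rightarrow> 's"
  assumes gr_r: "e \<in> gr S \<Longrightarrow> gr (r S e) = gr S - {e}"
    and r_r: "\<lbrakk>e \<in> gr S; f \<in> gr S; e \<noteq> f\<rbrakk> \<Longrightarrow> r (r S e) f = r (r S f) e"
begin

definition remove_set :: "'s \<Rightarrow> 'e set \<Rightarrow> 's" where
  "remove_set S A = foldl r S (some_enum A)"

text \<open>\<open>e\<close> moves to the front by commuting past the elements before it, one at a
  time.\<close>

lemma foldl_remove1:
  assumes "distinct xs" "set xs \<subseteq> gr S" "e \<in> set xs"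
  shows "foldl r S xs = foldl r (r S e) (remove1 e xs)"
  using assms
proof (induction xs arbitrary: S)
  case (Cons x xs)
  show ?case
  proof (cases "x = e")
    case False
    then have "foldl r (r S x) xs = foldl r (r (r S x) e) (remove1 e xs)"
      using Cons.prems by (intro Cons.IH) (auto simp: gr_r)
    then show ?thesis
      using False Cons.prems by (auto simp: r_r)
  qed simp
qed simp

lemma foldl_cong_set:
  assumes "distinct xs" "distinct ys" "set xs = set ys" "set xs \<subseteq> gr S"
  shows "foldl r S xs = foldl r S ys"
  using assms
proof (induction xs arbitrary: S ys)
  case (Cons x xs)
  have "foldl r (r S x) xs = foldl r (r S x) (remove1 x ys)"
  proof (rule Cons.IH)
    show "set xs \<subseteq> gr (r S x)"
      using Cons.prems gr_r [of x S] by auto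
  qed (use Cons.prems in auto)
  also have "\<dots> = foldl r S ys"
    using Cons.prems by (intro foldl_remove1 [symmetric]) auto
  finally show ?case by simp
qed simp

text \<open>Replaces the enumeration picked by Hilbert choice in \<open>some_enum\<close> with any
  convenient one.\<close>

lemma remove_set_eq_foldl:
  assumes "distinct xs" "set xs \<subseteq> gr S"
  shows "remove_set S (set xs) = foldl r S xs"
proof -
  have "distinct (some_enum (set xs)) \<and> set (some_enum (set xs)) = set xs"
    unfolding some_enum_def by (rule someI [where x = xs]) (use assms in auto)
  then show ?thesis
    using assms unfolding remove_set_def by (intro foldl_cong_set) auto
qed

lemma remove_set_empty [simp]: "remove_set S {} = S"
  using remove_set_eq_foldl [of "[]" S] by simp

lemma remove_set_insert:
  assumes "finite A" "insert e A \<subseteq> gr S" "e \<notin> A"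
  shows "remove_set S (insert e A) = remove_set (r S e) A"
proof -
  obtain xs where xs: "distinct xs" "set xs = A"
    using finite_distinct_list [OF \<open>finite A\<close>] by blast
  show ?thesis
    using remove_set_eq_foldl [of "e # xs" S] remove_set_eq_foldl [of xs "r S e"] xs assms
    by (simp add: gr_r subset_Diff_insert)
qed

lemma gr_remove_set:
  assumes "finite A" "A \<subseteq> gr S"
  shows "gr (remove_set S A) = gr S - A"
  using assms
proof (induction A arbitrary: S rule: finite_induct)
  case (insert e A)
  then have "A \<subseteq> gr (r S e)"
    by (auto simp: gr_r)
  then show ?case
    using insert by (auto simp: remove_set_insert gr_r)
qed simp

text \<open>Here \<open>q\<close> stands for the operation of the other kind at the fixed element
  \<open>e\<close>: contraction if \<open>r\<close> is deletion, and vice versa.\<close>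

lemma remove_set_commute:
  assumes q: "\<And>S f. \<lbrakk>e \<in> gr S; f \<in> gr S; f \<noteq> e\<rbrakk> \<Longrightarrow> q (r S f) = r (q S) f"
    and gr_q: "\<And>S. e \<in> gr S \<Longrightarrow> gr (q S) = gr S - {e}"
    and "finite A" "insert e A \<subseteq> gr S" "e \<notin> A"
  shows "q (remove_set S A) = remove_set (q S) A"
  using assms(3-)
proof (induction A arbitrary: S rule: finite_induct)
  case (insert f A)
  then have "e \<in> gr (r S f)" "A \<subseteq> gr (r S f)"
    by (auto simp: gr_r)
  moreover have "insert f A \<subseteq> gr (q S)"
    using insert by (auto simp: gr_q)
  ultimately show ?case
    using insert by (auto simp: remove_set_insert q)
qed simp

end


section \<open>Minors\<close>

context minors_system
begin

sublocale del: removal "ground M" "del M"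
  by unfold_locales (simp_all add: ground_del del_del)

sublocale contr: removal "ground M" "contr M"
  by unfold_locales (simp_all add: ground_contr contr_contr)

lemma del_set_eq: "del_set M = del.remove_set"
  by (simp add: fun_eq_iff del_set_def del.remove_set_def)

lemma contr_set_eq: "contr_set M = contr.remove_set"
  by (simp add: fun_eq_iff contr_set_def contr.remove_set_def)

lemma finite_ground [simp]: "finite (ground M S)"
  using graded by (auto simp: grade_def)

lemma in_grade_iff: "S \<in> grade M n \<longleftrightarrow> card (ground M S) = n"
  by (simp add: grade_def)

lemma finite_subset_ground: "A \<subseteq> ground M S \<Longrightarrow> finite A"
  using finite_subset finite_ground by blast

lemma del_set_empty [simp]: "del_set M S {} = S"
  and contr_set_empty [simp]: "contr_set M S {} = S"
  by (simp_all add: del_set_eq contr_set_eq)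

lemma contr_set_singleton: "e \<in> ground M S \<Longrightarrow> contr_set M S {e} = contr M S e"
  by (simp add: contr_set_eq contr.remove_set_insert)

lemma ground_del_set: "A \<subseteq> ground M S \<Longrightarrow> ground M (del_set M S A) = ground M S - A"
  by (simp add: del_set_eq del.gr_remove_set finite_subset_ground)

lemma ground_contr_set: "A \<subseteq> ground M S \<Longrightarrow> ground M (contr_set M S A) = ground M S - A"
  by (simp add: contr_set_eq contr.gr_remove_set finite_subset_ground)

lemma del_set_insert:
  "\<lbrakk>insert e A \<subseteq> ground M S; e \<notin> A\<rbrakk> \<Longrightarrow> del_set M S (insert e A) = del_set M (del M S e) A"
  using finite_subset_ground [of A S] by (simp add: del_set_eq del.remove_set_insert)

lemma contr_set_insert:
  "\<lbrakk>insert e A \<subseteq> ground M S; e \<notin> A\<rbrakk> \<Longrightarrow> contr_set M S (insert e A) = contr_set M (contr M S e) A"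
  using finite_subset_ground [of A S] by (simp add: contr_set_eq contr.remove_set_insert)

lemma contr_del_set:
  "\<lbrakk>insert e A \<subseteq> ground M S; e \<notin> A\<rbrakk> \<Longrightarrow> contr M (del_set M S A) e = del_set M (contr M S e) A"
  using finite_subset_ground [of A S] unfolding del_set_eq
  by (intro del.remove_set_commute) (auto simp: ground_contr del_contr)

lemma del_contr_set:
  "\<lbrakk>insert e A \<subseteq> ground M S; e \<notin> A\<rbrakk> \<Longrightarrow> del M (contr_set M S A) e = contr_set M (del M S e) A"
  using finite_subset_ground [of A S] unfolding contr_set_eq
  by (intro contr.remove_set_commute) (auto simp: ground_del del_contr)

lemma del_set_Un:
  assumes "A \<inter> B = {}" "A \<union> B \<subseteq> ground M S"
  shows "del_set M (del_set M S A) B = del_set M S (A \<union> B)"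
proof -
  have "finite A"
    using assms finite_subset_ground by blast
  then show ?thesis
    using assms
  proof (induction A arbitrary: S rule: finite_induct)
    case (insert e A)
    then have "A \<union> B \<subseteq> ground M (del M S e)"
      by (auto simp: ground_del)
    then show ?case
      using insert by (simp add: del_set_insert)
  qed simp
qed

lemma contr_set_Un:
  assumes "A \<inter> B = {}" "A \<union> B \<subseteq> ground M S"
  shows "contr_set M (contr_set M S A) B = contr_set M S (A \<union> B)"
proof -
  have "finite A"
    using assms finite_subset_ground by blast
  then show ?thesis
    using assms
  proof (induction A arbitrary: S rule: finite_induct)
    case (insert e A)
    then have "A \<union> B \<subseteq> ground M (contr M S e)"
      by (auto simp: ground_contr)
    then show ?case
      using insert by (simp add: contr_set_insert)
  qed simp
qed


section \<open>Convolution powers of selectors\<close>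

lemma coprod_basis:
  "coprod M (basis S) = (\<Sum>A\<in>Pow (ground M S). basis (del_set M S (ground M S - A), contr_set M S A))"
  by (simp add: coprod_def)

lemma conv_basis:
  "conv M f g (basis S) =
    (\<Sum>A\<in>Pow (ground M S). f (basis (del_set M S (ground M S - A))) * g (basis (contr_set M S A)))"
  by (simp add: conv_def mult_tensor_def coprod_basis lin_ext_sum)

section \<open>Summands of iterated coproducts\<close>

lemma iter_coprod_Suc_basis:
  "iter_coprod M (Suc n) (basis S) = (\<Sum>A\<in>Pow (ground M S).
    tensor_cons (del_set M S (ground M S - A)) (iter_coprod M n (basis (contr_set M S A))))"
  by (simp add: coprod_basis lin_ext_sum)

lemma lookup_iter_coprod_Nats:
  "Poly_Mapping.lookup (iter_coprod M n (basis S) :: 's list \<Rightarrow>\<^sub>0 'k::field_char_0) us \<in> \<nat>"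
proof (induction n arbitrary: S us)
  case 0
  then show ?case by (simp add: lookup_single when_def)
next
  case (Suc n)
  then show ?case
    unfolding iter_coprod_Suc_basis lookup_sum
    by (intro sum_in_Nats) (auto simp: lookup_tensor_cons split: list.split)
qed

lemma summands_0 [simp]: "summands TYPE('k::field_char_0) M 0 S = {[S]}"
  by (simp add: summands_def)

text \<open>The coefficients of an iterated coproduct are natural numbers, hence nothing cancels.\<close>

lemma Cons_in_summands_Suc:
  assumes "A \<subseteq> ground M S" "us \<in> summands TYPE('k::field_char_0) M n (contr_set M S A)"
  shows "del_set M S (ground M S - A) # us \<in> summands TYPE('k) M (Suc n) S"
proof -
  let ?us = "del_set M S (ground M S - A) # us"
  let ?p = "\<lambda>B. tensor_cons (del_set M S (ground M S - B))
    (iter_coprod M n (basis (contr_set M S B))) :: 's list \<Rightarrow>\<^sub>0 'k"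
  have "Poly_Mapping.lookup (?p B) ?us \<in> \<nat>" for B
    by (simp add: lookup_tensor_cons lookup_iter_coprod_Nats)
  then obtain c where c: "\<And>B. Poly_Mapping.lookup (?p B) ?us = of_nat (c B)"
    unfolding Nats_def image_iff by metis
  have "c A \<noteq> 0"
    using assms(2) c [of A] by (auto simp: lookup_tensor_cons summands_def in_keys_iff)
  then have "(\<Sum>B\<in>Pow (ground M S). c B) \<noteq> 0"
    using assms(1) by auto
  \<comment> \<open>Characteristic 0 enters here: \<open>of_nat\<close> sends a nonzero natural
    number to a nonzero scalar.\<close>
  then have "(\<Sum>B\<in>Pow (ground M S). Poly_Mapping.lookup (?p B) ?us) \<noteq> 0"
    unfolding c of_nat_sum [symmetric] of_nat_eq_0_iff .
  then show ?thesis
    unfolding summands_def in_keys_iff iter_coprod_Suc_basis lookup_sum .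
qed

text \<open>The tensor factors of the summand of the iterated coproduct given by an ordering of the ground set.\<close>

primrec factors :: "'s \<Rightarrow> 'e list \<Rightarrow> 's list" where
  "factors S [] = []"
| "factors S (e # es) = del_set M S (ground M S - {e}) # factors (contr M S e) es"

text \<open>Take \<open>A = {e}\<close> in the outermost coproduct and recurse on the contraction of
  \<open>e\<close>. An ordering of n elements uses n - 1 coproducts, so the induction really starts
  at one-element orderings, where the iterated coproduct is the identity.\<close>

lemma factors_in_summands:
  assumes "distinct es" "set es = ground M S" "es \<noteq> []"
  shows "factors S es \<in> summands TYPE('k::field_char_0) M (length es - 1) S"
  using assms
proof (induction es arbitrary: S)
  case (Cons e es)
  show ?case
  proof (cases es)
    case Nil
    then show ?thesis
      using Cons.prems by (simp flip: Cons.prems(2))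
  next
    case (Cons f fs)
    have e: "e \<in> ground M S"
      using Cons.prems by auto
    then have "factors (contr M S e) es \<in> summands TYPE('k) M (length es - 1) (contr_set M S {e})"
      using Cons Cons.prems Cons.IH [of "contr M S e"] by (auto simp: ground_contr contr_set_singleton)
    from Cons_in_summands_Suc [OF _ this] show ?thesis
      using e Cons by simp
  qed
qed simp

lemma set_factors:
  assumes "distinct es" "set es \<subseteq> ground M S"
  shows "set (factors S es) \<subseteq> grade M 1"
  using assms
proof (induction es arbitrary: S)
  case (Cons e es)
  then have "set (factors (contr M S e) es) \<subseteq> grade M 1"
    by (intro Cons.IH) (auto simp: ground_contr)
  moreover have "ground M S - (ground M S - {e}) = {e}"
    using Cons.prems by auto
  ultimately show ?case
    by (simp add: in_grade_iff ground_del_set)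
qed simp

text \<open>Each factor deletes all elements later in the ordering and contracts all earlier ones.
  Hence the last element \<open>e\<close> is deleted in every earlier factor, and its own factor has
  everything else contracted. Since the operations commute, the deletion of \<open>e\<close> can be
  done first.\<close>

lemma factors_snoc:
  assumes "distinct (es @ [e])" "set (es @ [e]) = ground M S"
  shows "factors S (es @ [e]) = factors (del M S e) es @ [contr_set M S (ground M S - {e})]"
  using assms
proof (induction es arbitrary: S)
  case Nil
  then have "ground M S = {e}"
    by simp
  then show ?case
    by simp
next
  case (Cons f es)
  then have fe: "f \<in> ground M S" "e \<in> ground M S" "f \<noteq> e" "set es = ground M S - {e} - {f}"
    by auto
  then have *: "ground M S - {f} = insert e (ground M S - {e} - {f})"
    "ground M S - {e} = insert f (ground M S - {f} - {e})"
    by auto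
  have "factors (contr M S f) (es @ [e]) =
      factors (del M (contr M S f) e) es @ [contr_set M (contr M S f) (ground M (contr M S f) - {e})]"
    by (rule Cons.IH) (use Cons.prems fe in \<open>auto simp: ground_contr\<close>)
  moreover have "del_set M S (ground M S - {f}) = del_set M (del M S e) (ground M S - {e} - {f})"
    by (subst *) (rule del_set_insert, use fe in auto)
  moreover have "contr_set M S (ground M S - {e}) = contr_set M (contr M S f) (ground M S - {f} - {e})"
    by (subst *) (rule contr_set_insert, use fe in auto)
  ultimately show ?case
    using fe by (simp add: ground_contr ground_del del_contr)
qed

end

section \<open>The convolution exponential of a uniform map\<close>

text \<open>Isolates what the argument uses of a selector: its values on basis elements vanish
  outside degree one, and it is uniform.\<close>

locale uniform_map = minors_system M
  for M :: "('s, 'e) minors_struct" +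
  fixes d :: "('s \<Rightarrow>\<^sub>0 'k::field_char_0) \<Rightarrow> ('x, 'k) rpoly"
  assumes vanish: "S \<notin> grade M 1 \<Longrightarrow> d (basis S) = 0"
    and unif: "uniform M d"
begin

text \<open>The value of the tensor power of \<open>d\<close> on the summand belonging to the
  ordering \<open>es\<close>.\<close>

definition weight :: "'s \<Rightarrow> 'e list \<Rightarrow> ('x, 'k) rpoly" where
  "weight S es = (\<Prod>T\<leftarrow>factors S es. d (basis T))"

lemma weight_simps [simp]:
  "weight S [] = 1"
  "weight S (e # es) = d (basis (del_set M S (ground M S - {e}))) * weight (contr M S e) es"
  by (simp_all add: weight_def)

lemma weight_snoc:
  assumes "distinct (es @ [e])" "set (es @ [e]) = ground M S"
  shows "weight S (es @ [e]) = weight (del M S e) es * d (basis (contr_set M S (ground M S - {e})))"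
  unfolding weight_def factors_snoc [OF assms] by simp

text \<open>The one place where uniformity is applied: both orderings give summands of the same
  iterated coproduct with all factors in degree one.\<close>

lemma weight_cong:
  assumes "distinct es" "set es = ground M S" "distinct fs" "set fs = ground M S"
  shows "weight S es = weight S fs"
\<comment> \<open>Uniformity speaks only of k \<ge> 1, so the empty ordering is treated
  apart.\<close>
proof (cases "es = []")
  case False
  then have "fs \<noteq> []" and len: "length fs = length es"
    using assms by (auto simp flip: distinct_card)
  then have "factors S es \<in> summands TYPE('k) M (length es - 1) S"
    "factors S fs \<in> summands TYPE('k) M (length es - 1) S"
    using factors_in_summands [of es S, where 'k = 'k] factors_in_summands [of fs S, where 'k = 'k] False assms
    by auto
  moreover have "length es \<ge> 1"
    using False by (cases es) auto
  ultimately have "tensor_power d (basis (factors S es)) = tensor_power d (basis (factors S fs))"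
    using unif set_factors [of es S] set_factors [of fs S] assms unfolding uniform_def by blast
  then show ?thesis
    by (simp add: weight_def tensor_power_def)
qed (use assms in auto)

text \<open>The left tensor factor indexed by \<open>A\<close> has ground set \<open>A\<close>, so
  \<open>d\<close> kills it unless \<open>A\<close> is a singleton.\<close>

lemma conv_power_Suc_basis:
  "conv_power M d (Suc n) (basis S) = (\<Sum>e\<in>ground M S.
    d (basis (del_set M S (ground M S - {e}))) * conv_power M d n (basis (contr M S e)))"
proof -
  let ?t = "\<lambda>A. d (basis (del_set M S (ground M S - A))) * conv_power M d n (basis (contr_set M S A))"
  have "conv_power M d (Suc n) (basis S) = (\<Sum>A\<in>Pow (ground M S). ?t A)"
    by (simp add: conv_basis)
  also have "\<dots> = (\<Sum>A\<in>(\<lambda>e. {e}) ` ground M S. ?t A)"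
  proof (rule sum.mono_neutral_right)
    show "\<forall>A\<in>Pow (ground M S) - (\<lambda>e. {e}) ` ground M S. ?t A = 0"
    proof
      fix A assume A: "A \<in> Pow (ground M S) - (\<lambda>e. {e}) ` ground M S"
      then have "ground M (del_set M S (ground M S - A)) = A"
        by (auto simp: ground_del_set)
      moreover have "card A \<noteq> 1"
        using A by (auto simp: card_1_singleton_iff)
      ultimately show "?t A = 0"
        by (simp add: vanish in_grade_iff)
    qed
  qed auto
  also have "\<dots> = (\<Sum>e\<in>ground M S. ?t {e})"
    by (simp add: sum.reindex)
  finally show ?thesis
    by (simp add: contr_set_singleton)
qed

text \<open>Each convolution factor uses up exactly one element of the ground set.\<close>

lemma conv_power_eq_0:
  "card (ground M S) \<noteq> n \<Longrightarrow> conv_power M d n (basis S) = 0"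
proof (induction n arbitrary: S)
  case 0
  then show ?case by (simp add: counit_def in_grade_iff)
next
  case (Suc n)
  then have "conv_power M d n (basis (contr M S e)) = 0" if "e \<in> ground M S" for e
    using that card_Suc_Diff1 [of "ground M S" e] by (intro Suc.IH) (auto simp: ground_contr)
  then show ?case
    unfolding conv_power_Suc_basis by simp
qed

text \<open>Each of the n + 1 choices of a first element contributes n! times the same
  weight.\<close>

lemma conv_power_eq_weight:
  assumes "distinct es" "set es = ground M S"
  shows "conv_power M d (length es) (basis S) = fact (length es) * weight S es"
  using assms
proof (induction "length es" arbitrary: S es)
  case 0
  then show ?case by (simp add: counit_def in_grade_iff)
next
  case (Suc n)
  have "d (basis (del_set M S (ground M S - {e}))) * conv_power M d n (basis (contr M S e)) =
      fact n * weight S es" if e: "e \<in> ground M S" for e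
  proof -
    obtain es' where es': "distinct es'" "set es' = ground M S - {e}"
      using finite_distinct_list [of "ground M S - {e}"] by auto
    then have "length es' = n"
      using Suc.hyps(2) Suc.prems e by (simp flip: distinct_card)
    then have "conv_power M d n (basis (contr M S e)) = fact n * weight (contr M S e) es'"
      using Suc.hyps(1) [of es' "contr M S e"] es' e by (simp add: ground_contr)
    \<comment> \<open>Reordering so that \<open>e\<close> comes first makes the contribution of
      \<open>e\<close> independent of \<open>e\<close>.\<close>
    moreover have "weight S es = weight S (e # es')"
      using Suc.prems es' e by (intro weight_cong) auto
    ultimately show ?thesis
      by (simp add: mult_ac)
  qed
  moreover have "card (ground M S) = Suc n"
    using Suc.hyps(2) Suc.prems by (simp flip: distinct_card)
  ultimately show ?case
    unfolding Suc.hyps(2) [symmetric] conv_power_Suc_basis by (simp add: algebra_simps)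
qed

text \<open>Only the term of the exponential series whose index is the size of the ground set
  survives, and its 1/n! cancels the number of orderings.\<close>

lemma conv_exp_eq_weight:
  assumes "distinct es" "set es = ground M S"
  shows "conv_exp M d (basis S) = weight S es"
proof -
  have "card (ground M S) = length es"
    using assms by (simp flip: distinct_card)
  then have "conv_exp M d (basis S) =
      Sum_any (\<lambda>k. if k = length es then smult (1 / fact k) (conv_power M d k (basis S)) else 0)"
    unfolding conv_exp_def by (intro Sum_any.cong) (auto simp: conv_power_eq_0)
  also have "\<dots> = smult (1 / of_nat (fact (length es))) (of_nat (fact (length es)) * weight S es)"
    using assms by (simp add: conv_power_eq_weight)
  finally show ?thesis
    by (simp only: smult_inverse_of_nat_mult fact_nonzero not_False_eq_True)
qed

lemma conv_exp_one: "ground M S = {} \<Longrightarrow> conv_exp M d (basis S) = 1"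
  using conv_exp_eq_weight [of "[]" S] by simp

text \<open>Evaluate on an ordering with \<open>e\<close> first; its tail orders the ground set of
  the contraction.\<close>

lemma conv_exp_contr:
  assumes e: "e \<in> ground M S"
  shows "conv_exp M d (basis S) =
    d (basis (del_set M S (ground M S - {e}))) * conv_exp M d (basis (contr M S e))"
proof -
  obtain es where "distinct es" "set es = ground M S - {e}"
    using finite_distinct_list [of "ground M S - {e}"] by auto
  then show ?thesis
    using e conv_exp_eq_weight [of "e # es" S] conv_exp_eq_weight [of es "contr M S e"]
    by (auto simp: ground_contr insert_absorb)
qed

text \<open>Dually, put \<open>e\<close> last; by \<open>weight_snoc\<close> the rest is an ordering
  for the deletion.\<close>

lemma conv_exp_del:
  assumes e: "e \<in> ground M S"
  shows "conv_exp M d (basis S) =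
    d (basis (contr_set M S (ground M S - {e}))) * conv_exp M d (basis (del M S e))"
proof -
  obtain es where "distinct es" "set es = ground M S - {e}"
    using finite_distinct_list [of "ground M S - {e}"] by auto
  then show ?thesis
    using e conv_exp_eq_weight [of "es @ [e]" S] conv_exp_eq_weight [of es "del M S e"]
      weight_snoc [of es e S]
    by (auto simp: ground_del insert_absorb mult.commute)
qed

end


section \<open>Deletion and contraction\<close>

lemma selector_eq_0:
  fixes S :: 's
  assumes "S \<notin> grade M 1"
  shows "selector M a (basis S) = 0"
proof -
  \<comment> \<open>Every index \<open>i\<close> has degree one, hence differs from
    \<open>S\<close>, and \<open>delta i\<close> vanishes on \<open>basis S\<close>.\<close>
  have "selector M a (basis S) = Sum_any (\<lambda>_ :: 's. 0)"
    unfolding selector_def using assms by (intro Sum_any.cong) (auto simp: delta_def)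
  then show ?thesis by simp
qed

text \<open>Separates the subsets avoiding \<open>e\<close> from those containing it.\<close>

lemma sum_Pow_split:
  assumes "finite E" "e \<in> E"
  shows "(\<Sum>A\<in>Pow E. f A) = (\<Sum>A\<in>Pow (E - {e}). f A) + (\<Sum>A\<in>Pow (E - {e}). f (insert e A))"
proof -
  have "Pow E = Pow (E - {e}) \<union> insert e ` Pow (E - {e})"
    using Pow_insert [of e "E - {e}"] assms by (simp add: insert_absorb)
  moreover have "inj_on (insert e) (Pow (E - {e}))"
    by (auto simp: inj_on_def)
  ultimately show ?thesis
    using assms by (subst sum.union_disjoint [symmetric, THEN trans [rotated]])
      (auto simp: sum.reindex sum.union_disjoint)
qed

context minors_system
begin

lemma conv_exp_conv_exp_deletion_contraction:
  assumes "uniform_map M d" "uniform_map M d'" and e: "e \<in> ground M S"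
  shows "conv M (conv_exp M d) (conv_exp M d') (basis S) =
    d' (basis (contr_set M S (ground M S - {e}))) *
      conv M (conv_exp M d) (conv_exp M d') (basis (del M S e)) +
    d (basis (del_set M S (ground M S - {e}))) *
      conv M (conv_exp M d) (conv_exp M d') (basis (contr M S e))"
proof -
  interpret d: uniform_map M d by fact
  interpret d': uniform_map M d' by fact
  let ?E = "ground M S"
  let ?t = "\<lambda>S A. conv_exp M d (basis (del_set M S (ground M S - A))) * conv_exp M d' (basis (contr_set M S A))"
  \<comment> \<open>Terms with \<open>e\<close> outside \<open>A\<close>: \<open>e\<close> is
    already deleted on the left and still present on the right, where \<open>conv_exp_del\<close>
    splits it off. The factor obtained contracts first \<open>A\<close>, then everything else but
    \<open>e\<close>, so it does not depend on \<open>A\<close>.\<close>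
  have "?t S A = d' (basis (contr_set M S (?E - {e}))) * ?t (del M S e) A" if A: "A \<subseteq> ?E - {e}" for A
  proof -
    have "?E - A = insert e (?E - {e} - A)"
      using A e by auto
    moreover have "del_set M S (insert e (?E - {e} - A)) = del_set M (del M S e) (?E - {e} - A)"
      using e by (intro del_set_insert) auto
    ultimately have "del_set M S (?E - A) = del_set M (del M S e) (ground M (del M S e) - A)"
      using e by (simp add: ground_del)
    moreover have "conv_exp M d' (basis (contr_set M S A)) =
        d' (basis (contr_set M S (?E - {e}))) * conv_exp M d' (basis (contr_set M (del M S e) A))"
    proof -
      have gr: "ground M (contr_set M S A) = ?E - A"
        using A by (intro ground_contr_set) auto
      then have "contr_set M (contr_set M S A) (?E - A - {e}) = contr_set M S (A \<union> (?E - A - {e}))"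
        using A by (intro contr_set_Un) auto
      moreover have "A \<union> (?E - A - {e}) = ?E - {e}"
        using A by auto
      moreover have "del M (contr_set M S A) e = contr_set M (del M S e) A"
        using A e by (intro del_contr_set) auto
      ultimately show ?thesis
        using d'.conv_exp_del [of e "contr_set M S A"] A e gr by auto
    qed
    ultimately show ?thesis by (simp add: mult_ac)
  qed
  \<comment> \<open>Terms containing \<open>e\<close>: it is already contracted on the right and
    still present on the left, where \<open>conv_exp_contr\<close> splits off a factor again
    independent of \<open>A\<close>.\<close>
  moreover have "?t S (insert e A) = d (basis (del_set M S (?E - {e}))) * ?t (contr M S e) A"
    if A: "A \<subseteq> ?E - {e}" for A
  proof -
    let ?B = "?E - insert e A"
    have "contr_set M S (insert e A) = contr_set M (contr M S e) A"
      using A e by (intro contr_set_insert) auto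
    moreover have "conv_exp M d (basis (del_set M S ?B)) = d (basis (del_set M S (?E - {e}))) *
        conv_exp M d (basis (del_set M (contr M S e) (ground M (contr M S e) - A)))"
    proof -
      have gr: "ground M (del_set M S ?B) = insert e A"
        using A e by (auto simp: ground_del_set)
      have "del_set M (del_set M S ?B) (insert e A - {e}) = del_set M S (?B \<union> (insert e A - {e}))"
        using A e by (intro del_set_Un) auto
      moreover have "?B \<union> (insert e A - {e}) = ?E - {e}"
        using A by auto
      moreover have "contr M (del_set M S ?B) e = del_set M (contr M S e) ?B"
        using e by (intro contr_del_set) auto
      moreover have "?B = ground M (contr M S e) - A"
        using e by (auto simp: ground_contr)
      ultimately show ?thesis
        using d.conv_exp_contr [of e "del_set M S ?B"] gr by simp
    qed
    ultimately show ?thesis by (simp add: mult_ac)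
  qed
  \<comment> \<open>With the common factors pulled out, the two sums over subsets of the ground set
    without \<open>e\<close> are the convolutions evaluated at the deletion and at the
    contraction.\<close>
  ultimately show ?thesis
    using e unfolding conv_basis sum_Pow_split [OF finite_ground e]
    by (simp add: sum_distrib_left ground_del ground_contr)
qed

end

theorem theorem4p1:
  fixes M :: "('s, 'e) minors_struct"
    and a b :: "'s \<Rightarrow> ('x, 'k::field_char_0) rpoly"
  assumes "minors_system M"
    and "uniform M (selector M a)"
    and "uniform M (selector M b)"
  shows "(\<forall>S \<in> grade M 0. canonical_tutte M a b (basis S) = 1) \<and>
    (\<forall>S. S \<notin> grade M 0 \<longrightarrow> (\<forall>e \<in> ground M S.
      canonical_tutte M a b (basis S) =
        selector M b (basis (contr_set M S (ground M S - {e}))) *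
          canonical_tutte M a b (basis (del M S e)) +
        selector M a (basis (del_set M S (ground M S - {e}))) *
          canonical_tutte M a b (basis (contr M S e))))"
proof -
  interpret minors_system M by fact
  interpret a: uniform_map M "selector M a"
    by unfold_locales (simp_all add: selector_eq_0 assms)
  interpret b: uniform_map M "selector M b"
    by unfold_locales (simp_all add: selector_eq_0 assms)
  show ?thesis
    unfolding canonical_tutte_def
  proof (intro conjI ballI allI impI)
    fix S assume "S \<in> grade M 0"
    then have "ground M S = {}"
      by (simp add: in_grade_iff)
    then show "conv M (conv_exp M (selector M a)) (conv_exp M (selector M b)) (basis S) = 1"
      by (simp add: conv_basis a.conv_exp_one b.conv_exp_one)
  qed (rule conv_exp_conv_exp_deletion_contraction, unfold_locales)
qed

end
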